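(* Let $f_1,\dots,f_n$ be the local objective functions of $n$ nodes and $f(\mathbf{x})=\sum_{i=1}^n f_i(\mathbf{x})$, $\mathbf{x}\in\mathbb{R}^p$. Suppose that $f$ is twice continuously differentiable and $\mu$-strongly convex, i.e. there is $\mu>0$ with $\nabla^2 f(\mathbf{x})\succeq\mu I$ for all $\mathbf{x}$, and that $f$ has $L$-Lipschitz continuous Hessian, i.e. $\|\nabla^2 f(\mathbf{x})-\nabla^2 f(\mathbf{y})\|\le L\|\mathbf{x}-\mathbf{y}\|$ for all $\mathbf{x},\mathbf{y}$. Suppose also that the communication network over the nodes $\mathcal{V}=\{1,\dots,n\}$ is strongly connected and that each node has a unique identifier. Let $\{\mathbf{x}_k^{(i)}\}$, $i\in\mathcal{V}$, be the sequences generated by the Distributed Adaptive Newton method (DAN) from the common starting point $\mathbf{x}_0$. Then all sequences $\{\mathbf{x}_k^{(i)}\}$, $i\in\mathcal{V}$, converge to an optimal point $\mathbf{x}^\star$, and $\|\nabla f(\mathbf{x}_k^{(i)})\|$ is monotonically decreasing. Moreover, let $$k_0=\max\Big\{0,\Big\lceil\frac{2L}{\mu^2}\|\nabla f(\mathbf{x}_0)\|\Big\rceil-2\Big\},\qquad \gamma=\frac{L}{2\mu^2}\|\nabla f(\mathbf{x}_0)\|-\frac{k_0}{4}\in\Big[0,\frac12\Big).$$ Then it holds that $$\|\nabla f(\mathbf{x}_k^{(i)})\|\le\begin{cases}\|\nabla f(\mathbf{x}_0)\|-\dfrac{\mu^2}{2L}k, & k\le k_0,\\[6pt] \dfrac{2\mu^2}{L}\gamma^{2^{(k-k_0)}},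 & k>k_0,\end{cases}$$ and $$\|\mathbf{x}_k^{(i)}-\mathbf{x}^\star\|\le\begin{cases}\dfrac{\mu}{L}\Big(k_0-k+\dfrac{2\gamma}{1-\gamma}\Big), & k\le k_0,\\[6pt] \dfrac{2\mu\,\gamma^{2^{(k-k_0)}}}{L\big(1-\gamma^{2^{(k-k_0)}}\big)}, & k>k_0.\end{cases}$$
   Context: $\|\cdot\|$ is the $\ell_2$-norm for vectors and the spectral norm for matrices; $A\succeq B$ means $A-B$ is non-negative definite; $\lceil x\rceil$ is the least integer greater than or equal to $x$. The optimal point $\mathbf{x}^\star$ is the (unique) global minimizer of $f$. The communication network is a directed graph $\mathcal{G}=(\mathcal{V},\mathcal{E})$, with $(i,j)\in\mathcal{E}$ if and only if node $i$ can directly send messages to node $j$; it is undirected if $(i,j)\in\mathcal{E}$ implies $(j,i)\in\mathcal{E}$. It is strongly connected if there is a directed path between any pair of nodes. Distributed Selective Flooding (DSF): node $i$ has a message $\mathcal{S}_i$ and sets $\mathcal{I}_i(0)=\{\mathcal{S}_i\}$. In each communication round $t=1,\dots,n-1$: if $\mathcal{G}$ is undirected, then for each neighbor $j$, node $i$ selects an element $e\in\mathcal{I}_i(t-1)$ that it has neither sent to node $j$ nor received from node $j$ before, and sends $e$ to $j$; if $\mathcal{G}$ is directed, then for each out-neighbor $j$, node $i$ selects an element $e\in\mathcal{I}_i(t-1)$ that it has not sent to $j$, and sends $e$ to $j$. Node $i$ receives an element $e_j$ from each neighbor $j$ that sends to it and sets $\mathcal{I}_i(t)$ to be $\mathcal{I}_i(t-1)$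 together with these elements. The output is $\mathcal{I}_i(n-1)=\{\mathcal{S}_u: u\in\mathcal{V}\}$ for all $i$, the messages of all nodes. (On an undirected network that is not a tree, a spanning tree is first constructed in a distributed manner and DSF is applied on it.) DAN: node $i$ privately holds $f_i$; all nodes start from the same point, $\mathbf{x}_0^{(i)}=\mathbf{x}_0$ for all $i$. At each iteration $k=0,1,2,\dots$, every node $i$: 1. computes $\mathbf{g}_k^{(i)}=\nabla f_i(\mathbf{x}_k^{(i)})$ and $H_k^{(i)}=\nabla^2 f_i(\mathbf{x}_k^{(i)})$; 2. obtains $\{(\mathbf{g}_k^{(u)},H_k^{(u)}):u\in\mathcal{V}\}$ by performing DSF via $n-1$ communication rounds with neighbors; 3. computes $\bar{\mathbf{g}}_k=\sum_{u=1}^n\mathbf{g}_k^{(u)}$ and $\bar H_k=\sum_{u=1}^n H_k^{(u)}$; 4. lets $\alpha_k^{(i)}=\min\big\{1,\frac{\mu^2}{L\|\bar{\mathbf{g}}_k\|}\big\}$ and updates $\mathbf{x}_{k+1}^{(i)}=\mathbf{x}_k^{(i)}-\alpha_k^{(i)}(\bar H_k)^{-1}\bar{\mathbf{g}}_k$.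
   Formalization: γ<1/2 fails when (2L/μ²)‖∇f(x₀)‖ is an integer ≥2 (then γ=1/2): γ∈[0,1/2] is claimed always, γ<1/2 otherwise, with all bounds kept. On directed networks only DSF runs that deliver all messages count, since the selection rule alone does not ensure this. *)

theory Defs
  imports "HOL-Analysis.Analysis" "Graph_Theory.Digraph_Component"
begin

section \<open>Gradients, Hessians and matrix inequalities\<close>

text \<open>Meaningful where \<open>f\<close> is differentiable: there \<open>GDERIV f x :> D\<close> determines \<open>D\<close>.\<close>

definition grad :: "(real^'p \<Rightarrow> real) \<Rightarrow> real^'p \<Rightarrow> real^'p" where
  "grad f x = (THE D. GDERIV f x :> D)"

definition hess :: "(real^'p \<Rightarrow> real) \<Rightarrow> real^'p \<Rightarrow> real^'p^'p" where
  "hess f x = jacobian (grad f) (at x)"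

definition twice_differentiable :: "(real^'p \<Rightarrow> real) \<Rightarrow> bool" where
  "twice_differentiable f \<longleftrightarrow>
     (\<forall>x. f differentiable (at x)) \<and> (\<forall>x. grad f differentiable (at x))"

definition twice_cont_differentiable :: "(real^'p \<Rightarrow> real) \<Rightarrow> bool" where
  "twice_cont_differentiable f \<longleftrightarrow>
     twice_differentiable f \<and> continuous_on UNIV (hess f)"

text \<open>The library's \<open>norm\<close> on \<open>real^'p^'p\<close> is the Frobenius norm, not the spectral norm.\<close>

definition spectral_norm :: "real^'p^'p \<Rightarrow> real" where
  "spectral_norm A = onorm ((*v) A)"

text \<open>Symmetry is not required of \<open>A - B\<close>; a Hessian of a \<open>C\<^sup>2\<close> function has it anyway.\<close>

definition loewner_ge :: "real^'p^'p \<Rightarrow> real^'p^'p \<Rightarrow> bool" (infix "\<succeq>" 50) where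
  "A \<succeq> B \<longleftrightarrow> (\<forall>v. 0 \<le> v \<bullet> ((A - B) *v v))"


section \<open>Undirected spanning trees\<close>

text \<open>
  An undirected graph is a symmetric digraph. In such a digraph the directed cycles of length 2
  just run back and forth along one edge, those of length 1 are loops, and all others are cycles
  of the undirected graph. The library's \<open>tree\<close> is not suitable here: \<open>forest\<close> excludes directed
  cycles only, so that no symmetric digraph with an arc is a \<open>tree\<close>, whereas a transitive
  tournament is one.
\<close>

definition undirected_tree :: "'v pair_pre_digraph \<Rightarrow> bool" where
  "undirected_tree T \<longleftrightarrow>
     symmetric T \<and> strongly_connected T \<and> (\<forall>p. pre_digraph.cycle T p \<longrightarrow> length p = 2)"

definition undirected_spanning_tree :: "'v pair_pre_digraph \<Rightarrow> 'v pair_pre_digraph \<Rightarrow> bool" where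
  "undirected_spanning_tree T G \<longleftrightarrow> undirected_tree T \<and> spanning T G"


section \<open>Distributed Selective Flooding\<close>

text \<open>
  In a transcript \<open>\<tau>\<close>, the value \<open>\<tau> t i j\<close> is what node \<open>i\<close> sends to node \<open>j\<close> in round \<open>t \<ge> 1\<close>
  (\<open>None\<close> if nothing).
\<close>

type_synonym ('v, 'm) transcript = "nat \<Rightarrow> 'v \<Rightarrow> 'v \<Rightarrow> 'm option"

definition sent_until :: "('v, 'm) transcript \<Rightarrow> nat \<Rightarrow> 'v \<Rightarrow> 'v \<Rightarrow> 'm set" where
  "sent_until \<tau> t i j = {e. \<exists>s\<in>{1..t}. \<tau> s i j = Some e}"

text \<open>
  The elements that \<open>i\<close> may select for \<open>j\<close> in round \<open>t + 1\<close>; the flag \<open>und\<close> tells whether the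
  rule for undirected networks is used.
\<close>

definition selectable ::
  "bool \<Rightarrow> ('v, 'm) transcript \<Rightarrow> (nat \<Rightarrow> 'v \<Rightarrow> 'm set) \<Rightarrow> nat \<Rightarrow> 'v \<Rightarrow> 'v \<Rightarrow> 'm set" where
  "selectable und \<tau> I t i j =
     I t i - sent_until \<tau> t i j - (if und then sent_until \<tau> t j i else {})"

text \<open>
  The selection is arbitrary, so a run is a relation. A node remains silent towards a neighbour
  only if nothing is selectable.
\<close>

definition dsf_run ::
  "bool \<Rightarrow> 'v pair_pre_digraph \<Rightarrow> ('v \<Rightarrow> 'm) \<Rightarrow> ('v, 'm) transcript \<Rightarrow>
   (nat \<Rightarrow> 'v \<Rightarrow> 'm set) \<Rightarrow> bool" where
  "dsf_run und G S \<tau> I \<longleftrightarrow>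
     (\<forall>i\<in>pverts G. I 0 i = {S i}) \<and>
     (\<forall>t < card (pverts G) - 1.
        (\<forall>(i, j)\<in>parcs G.
           case \<tau> (Suc t) i j of
             None \<Rightarrow> selectable und \<tau> I t i j = {}
           | Some e \<Rightarrow> e \<in> selectable und \<tau> I t i j) \<and>
        (\<forall>i\<in>pverts G.
           I (Suc t) i = I t i \<union> {e. \<exists>j. (j, i) \<in> parcs G \<and> \<tau> (Suc t) j i = Some e}))"

text \<open>
  \<open>Out i\<close> is the output at node \<open>i\<close> after \<open>n - 1\<close> rounds on the network \<open>G\<close>. On an undirected
  network, DSF is run on a spanning tree \<open>T\<close>, and nothing is assumed about the output. On a
  directed network, the rule alone does not enforce that every node ends up with all messages
  (with arcs 1-2, 2-1, 2-3, 3-1, node 1 may send to node 2 first its own message and then the one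
  that it has just received from node 2); there, only runs that do deliver all messages count.
\<close>

definition performs_dsf ::
  "'v pair_pre_digraph \<Rightarrow> 'v pair_pre_digraph \<Rightarrow> ('v \<Rightarrow> 'm) \<Rightarrow> ('v \<Rightarrow> 'm set) \<Rightarrow> bool" where
  "performs_dsf G T S Out \<longleftrightarrow>
     (\<exists>\<tau> I. Out = I (card (pverts G) - 1) \<and>
        (if symmetric G then dsf_run True T S \<tau> I
         else dsf_run False G S \<tau> I \<and> (\<forall>i\<in>pverts G. Out i = S ` pverts G)))"


section \<open>The Distributed Adaptive Newton method\<close>

text \<open>
  Messages carry the identifier of their origin, so that the messages of different nodes are
  different even if their gradients and Hessians agree. Each node sums over the messages that it
  has obtained itself.
\<close>

definition dan_message ::
  "(nat \<Rightarrow> 'id) \<Rightarrow> (nat \<Rightarrow> real^'p \<Rightarrow> real) \<Rightarrow> (nat \<Rightarrow> real^'p) \<Rightarrow> nat \<Rightarrow>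
   'id \<times> (real^'p) \<times> (real^'p^'p)" where
  "dan_message ident fl y u = (ident u, grad (fl u) (y u), hess (fl u) (y u))"

text \<open>
  For \<open>g = 0\<close> the stepsize is \<open>0\<close>, since division by zero gives zero in HOL, instead of \<open>1\<close>; the
  iterate does not move in either case.
\<close>

definition dan_stepsize :: "real \<Rightarrow> real \<Rightarrow> real^'p \<Rightarrow> real" where
  "dan_stepsize \<mu> L g = min 1 (\<mu>\<^sup>2 / (L * norm g))"

definition dan_update ::
  "real \<Rightarrow> real \<Rightarrow> ('id \<times> (real^'p) \<times> (real^'p^'p)) set \<Rightarrow> real^'p \<Rightarrow> real^'p" where
  "dan_update \<mu> L M y =
     (let g = (\<Sum>(_, gu, _)\<in>M. gu); H = (\<Sum>(_, _, Hu)\<in>M. Hu)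
      in y - dan_stepsize \<mu> L g *\<^sub>R (matrix_inv H *v g))"

text \<open>\<open>x i k\<close> is the iterate number \<open>k\<close> of node \<open>i\<close>.\<close>

definition dan ::
  "nat pair_pre_digraph \<Rightarrow> nat pair_pre_digraph \<Rightarrow> (nat \<Rightarrow> 'id) \<Rightarrow>
   (nat \<Rightarrow> real^'p \<Rightarrow> real) \<Rightarrow> real \<Rightarrow> real \<Rightarrow> real^'p \<Rightarrow> (nat \<Rightarrow> nat \<Rightarrow> real^'p) \<Rightarrow> bool" where
  "dan G T ident fl \<mu> L x0 x \<longleftrightarrow>
     (\<forall>i\<in>pverts G. x i 0 = x0) \<and>
     (\<forall>k. \<exists>Out. performs_dsf G T (dan_message ident fl (\<lambda>u. x u k)) Out \<and>
        (\<forall>i\<in>pverts G. x i (Suc k) = dan_update \<mu> L (Out i) (x i k)))"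

end

theory Submission
  imports Defs
begin

text \<open>
  Two arguments are combined: the flooding protocol delivers all messages to every node, so that
  all nodes perform the same centralized damped Newton step, and this step decreases the gradient
  norm at the stated rate.

  Flooding. On a directed network the delivery of all messages is part of the notion of a run, so
  let the protocol run on a tree. Cutting the edge between \<open>i\<close> and \<open>j\<close> leaves a branch on the side
  of \<open>i\<close>, which consists of \<open>i\<close> and the branches of the other neighbours \<open>k\<close> of \<open>i\<close>. Since
  elements are never sent back, node \<open>i\<close> sends to \<open>j\<close> only messages that originate from its own
  branch (\<open>sent_until_subset_branch\<close>). By induction on \<open>t\<close>, after \<open>t\<close> rounds it has sent at least
  \<open>min t m\<close> of them, where \<open>m\<close> is the size of the branch (\<open>card_sent_until\<close>), whatever the
  selections are. As \<open>m \<le> n - 1\<close>, after \<open>n - 1\<close> rounds \<open>j\<close> has the messages of all its neighbours'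
  branches, hence all messages (\<open>dsf_run_complete\<close>).

  Newton's method. Let \<open>g\<close> be the gradient of \<open>f\<close>, \<open>H\<close> its Hessian, and \<open>s = L / \<mu>\<^sup>2 * norm g\<close>.
  The Lipschitz condition bounds the linearization error of \<open>g\<close> by \<open>L / 2 * (norm d)\<^sup>2\<close>, and strong
  convexity bounds the Newton direction by \<open>norm g / \<mu>\<close>. A step of length \<open>\<alpha> = min 1 (1 / s)\<close>
  therefore leads to at most \<open>(1 - \<alpha>) * s + (\<alpha> * s)\<^sup>2 / 2\<close>, which is \<open>s - 1/2\<close> for \<open>s \<ge> 1\<close> and
  \<open>s\<^sup>2 / 2\<close> for \<open>s \<le> 1\<close> (\<open>dan_step\<close>). Iterating these two rules yields the bounds on the gradient
  norm, the number \<open>k0\<close> being such that the linear bound reaches \<open>2 * \<gamma> \<le> 1\<close> at \<open>k0\<close>; from there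
  on each step replaces \<open>s / 2\<close> by at most its square.

  Finally, strong monotonicity, \<open>\<mu> * norm (z - y) \<le> norm (g z - g y)\<close>, makes the iterates a Cauchy
  sequence because their gradients tend to \<open>0\<close>. The limit is a zero of \<open>g\<close>, which is the unique
  minimizer, and the distance of an iterate to it is at most its gradient norm divided by \<open>\<mu>\<close>.
  This is already at most the stated bound on the distance.
\<close>

section \<open>Branches of an undirected tree\<close>

text \<open>
  Used for an arc \<open>(i, j)\<close> of a tree \<open>T\<close>: the vertices on the side of \<open>i\<close> when the edge between
  \<open>i\<close> and \<open>j\<close> is cut, encoded as the vertices that \<open>i\<close> reaches without visiting \<open>j\<close>.
\<close>

definition branch :: "'v pair_pre_digraph \<Rightarrow> 'v \<Rightarrow> 'v \<Rightarrow> 'v set" where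
  "branch T i j = {v. (i, v) \<in> {(a, b) \<in> parcs T. a \<noteq> j \<and> b \<noteq> j}\<^sup>*}"

lemma branch_refl: "i \<in> branch T i j"
  by (simp add: branch_def)

lemma branch_step:
  assumes "v \<in> branch T i j" "(v, w) \<in> parcs T" "v \<noteq> j" "w \<noteq> j"
  shows "w \<in> branch T i j"
  using assms unfolding branch_def by (auto intro: rtrancl_into_rtrancl)

lemma branch_induct [consumes 1, case_names refl step]:
  assumes "v \<in> branch T i j"
    and "P i"
    and "\<And>v w. v \<in> branch T i j \<Longrightarrow> P v \<Longrightarrow> (v, w) \<in> parcs T \<Longrightarrow> v \<noteq> j \<Longrightarrow> w \<noteq> j \<Longrightarrow> P w"
  shows "P v"
proof -
  have "(i, v) \<in> {(a, b) \<in> parcs T. a \<noteq> j \<and> b \<noteq> j}\<^sup>*"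
    using assms(1) by (simp add: branch_def)
  then show ?thesis
  proof (induction rule: rtrancl_induct)
    case base
    show ?case by (rule assms(2))
  next
    case (step v w)
    then show ?case using assms(3)[of v w] by (auto simp: branch_def)
  qed
qed

lemma branch_avoids: "v \<in> branch T i j \<Longrightarrow> i \<noteq> j \<Longrightarrow> v \<noteq> j"
  by (induction rule: branch_induct) auto

locale undirected_tree_digraph = pair_wf_digraph T for T :: "'v pair_pre_digraph" +
  assumes undirected_tree: "undirected_tree T"
    and finite_vertices: "finite (pverts T)"
begin

lemma arc_sym: "(a, b) \<in> parcs T \<Longrightarrow> (b, a) \<in> parcs T"
  using undirected_tree by (auto simp: undirected_tree_def symmetric_def dest: symD)

lemma no_loop: "(a, b) \<in> parcs T \<Longrightarrow> a \<noteq> b"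
proof
  assume arc: "(a, b) \<in> parcs T" and eq: "a = b"
  have "cycle [(a, b)]"
    using arc eq by (auto simp: cycle_def awalk_def dest: wellformed')
  then show False
    using undirected_tree by (auto simp: undirected_tree_def)
qed

lemma branch_subset: "i \<in> pverts T \<Longrightarrow> branch T i j \<subseteq> pverts T"
proof
  fix v assume "v \<in> branch T i j" "i \<in> pverts T"
  then show "v \<in> pverts T"
    by (induction rule: branch_induct) (auto dest: wellformed')
qed

lemma finite_branch: "i \<in> pverts T \<Longrightarrow> finite (branch T i j)"
  using branch_subset finite_vertices finite_subset by metis

text \<open>
  Acyclicity enters only here: a path between two neighbours of \<open>i\<close> that avoids \<open>i\<close> would close
  to a cycle of length at least 3 through \<open>i\<close>.
\<close>

lemma neighbours_separated:
  assumes "(i, k) \<in> parcs T" "(i, k') \<in> parcs T" "k' \<in> branch T k i"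
  shows "k = k'"
proof (rule ccontr)
  assume ne: "k \<noteq> k'"
  define T' where "T' = \<lparr> pverts = pverts T - {i}, parcs = {(a, b) \<in> parcs T. a \<noteq> i \<and> b \<noteq> i} \<rparr>"
  interpret T': pair_wf_digraph T'
    by unfold_locales (auto simp: T'_def dest: wellformed')
  have ki: "k \<noteq> i" "k' \<noteq> i"
    using no_loop assms by metis+
  have "k \<rightarrow>\<^sup>*\<^bsub>T'\<^esub> k'"
    using assms(3)
  proof (induction rule: branch_induct)
    case refl
    have "k \<in> pverts T'"
      using in_arcsD2[OF assms(1)] ki by (simp add: T'_def)
    then show ?case
      by simp
  next
    case (step v w)
    have "(v, w) \<in> parcs T'"
      using step by (auto simp: T'_def)
    then show ?case
      by (rule T'.reachable_adj_trans[OF step.IH])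
  qed
  then obtain q where "T'.awalk k q k'"
    using T'.reachable_awalk by auto
  then have p: "T'.apath k (T'.awalk_to_apath q) k'"
    by (rule T'.apath_awalk_to_apath)
  define p where "p = T'.awalk_to_apath q"
  have aw: "T'.awalk k p k'" and dist: "distinct (pawalk_verts k p)"
    using p by (auto simp: p_def T'.apath_def)
  have verts: "set (pawalk_verts k p) \<subseteq> pverts T - {i}"
  proof
    fix v assume "v \<in> set (pawalk_verts k p)"
    then have "v \<in> pverts T'"
      using T'.awalk_verts_in_verts[of k p v] aw by (simp add: T'.awalk_def)
    then show "v \<in> pverts T - {i}"
      by (simp add: T'_def)
  qed
  have awT: "awalk k p k'"
  proof -
    have "pverts T' \<subseteq> pverts T" "parcs T' \<subseteq> parcs T"
      by (auto simp: T'_def)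
    then show ?thesis
      using aw unfolding T'.awalk_def awalk_def by blast
  qed
  have "awalk i ((i, k) # p @ [(k', i)]) i"
    using awT assms(1) arc_sym[OF assms(2)] in_arcsD1[OF assms(1)]
    by (simp add: awalk_Cons_iff awalk_append_iff awalk_Nil_iff)
  moreover have "pawalk_verts k (p @ [(k', i)]) = pawalk_verts k p @ [i]"
  proof -
    have "pcas k p k' \<Longrightarrow> ?thesis"
      by (induction p arbitrary: k) auto
    then show ?thesis using awT by (simp add: awalk_def)
  qed
  ultimately have "cycle ((i, k) # p @ [(k', i)])"
    using dist verts by (auto simp: cycle_def intro!: exI[of _ i])
  then have "length ((i, k) # p @ [(k', i)]) = 2"
    using undirected_tree by (auto simp: undirected_tree_def)
  then have "p = []" by simp
  with awT ne show False by (simp add: awalk_def)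
qed

lemma branches_disjoint:
  assumes "(i, k) \<in> parcs T" "(i, k') \<in> parcs T" "k \<noteq> k'"
  shows "branch T k i \<inter> branch T k' i = {}"
proof (rule ccontr)
  assume "\<not> ?thesis"
  then obtain v where v: "v \<in> branch T k i" "v \<in> branch T k' i" by blast
  let ?R = "{(a, b) \<in> parcs T. a \<noteq> i \<and> b \<noteq> i}"
  have "sym ?R"
    by (rule symI) (blast intro: arc_sym)
  then have "(v, k') \<in> ?R\<^sup>*"
    using v(2) unfolding branch_def by (auto dest: symD[OF sym_rtrancl])
  then have "k' \<in> branch T k i"
    using v(1) unfolding branch_def by (auto intro: rtrancl_trans)
  then show False
    using neighbours_separated assms by blast
qed

lemma branch_decomp:
  assumes "(i, j) \<in> parcs T"
  shows "branch T i j = insert i (\<Union>k\<in>{k. (k, i) \<in> parcs T} - {j}. branch T k i)"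
proof (intro equalityI subsetI)
  fix v assume "v \<in> branch T i j"
  then show "v \<in> insert i (\<Union>k\<in>{k. (k, i) \<in> parcs T} - {j}. branch T k i)"
  proof (induction rule: branch_induct)
    case (step v w)
    then show ?case
      by (blast intro: arc_sym branch_step branch_refl)
  qed simp
next
  fix v assume "v \<in> insert i (\<Union>k\<in>{k. (k, i) \<in> parcs T} - {j}. branch T k i)"
  then consider "v = i" | k where "(k, i) \<in> parcs T" "k \<noteq> j" "v \<in> branch T k i"
    by blast
  then show "v \<in> branch T i j"
  proof cases
    case 1
    then show ?thesis by (simp add: branch_refl)
  next
    case 2
    have ik: "(i, k) \<in> parcs T" using 2 arc_sym by blast
    have sep: "u \<noteq> j" if "u \<in> branch T k i" for u
      using neighbours_separated[OF ik assms] that 2(2) by blast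
    from 2(3) show ?thesis
    proof (induction rule: branch_induct)
      case refl
      then show ?case
        using branch_step[OF branch_refl ik] no_loop[OF assms] 2(2) by blast
    next
      case (step v w)
      moreover have "w \<in> branch T k i"
        using branch_step step by metis
      ultimately show ?case
        using branch_step[of v T i j w] sep by blast
    qed
  qed
qed

lemma branch_opposite_disjoint:
  assumes "(i, j) \<in> parcs T"
  shows "branch T i j \<inter> branch T j i = {}"
proof -
  have "branch T k i \<inter> branch T j i = {}" if "(k, i) \<in> parcs T" "k \<noteq> j" for k
    using branches_disjoint[of i k j] arc_sym that assms by blast
  moreover have "i \<notin> branch T j i"
    using branch_avoids[of i T j i] no_loop[OF assms] by blast
  ultimately show ?thesis
    unfolding branch_decomp[OF assms] by blast
qed

lemma vertices_decomp:
  assumes "i \<in> pverts T"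
  shows "pverts T = insert i (\<Union>k\<in>{k. (k, i) \<in> parcs T}. branch T k i)"
proof (intro equalityI subsetI)
  fix v assume "v \<in> pverts T"
  then have "i \<rightarrow>\<^sup>*\<^bsub>T\<^esub> v"
    using undirected_tree assms by (auto simp: undirected_tree_def strongly_connected_def)
  then have "(i, v) \<in> (parcs T)\<^sup>*"
    by (auto simp: reachable_def intro: rtrancl_on_rtranclI)
  then show "v \<in> insert i (\<Union>k\<in>{k. (k, i) \<in> parcs T}. branch T k i)"
  proof (induction rule: rtrancl_induct)
    case (step v w)
    then show ?case
      by (blast intro: arc_sym branch_step branch_refl)
  qed simp
next
  fix v assume "v \<in> insert i (\<Union>k\<in>{k. (k, i) \<in> parcs T}. branch T k i)"
  then show "v \<in> pverts T"
    using assms branch_subset by (auto dest: wellformed')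
qed

lemma card_branch:
  assumes "(i, j) \<in> parcs T"
  shows "card (branch T i j) = Suc (\<Sum>k\<in>{k. (k, i) \<in> parcs T} - {j}. card (branch T k i))"
proof -
  let ?K = "{k. (k, i) \<in> parcs T} - {j}"
  have fin: "finite ?K"
    by (rule finite_subset[OF _ finite_vertices]) (auto dest: wellformed')
  have fin_branch: "finite (branch T k i)" if "(k, i) \<in> parcs T" for k
    using finite_branch[OF in_arcsD1[OF that]] .
  have "card (\<Union>k\<in>?K. branch T k i) = (\<Sum>k\<in>?K. card (branch T k i))"
    using fin
    by (intro card_UN_disjoint ballI impI branches_disjoint[of i])
      (simp_all add: arc_sym fin_branch)
  moreover have "i \<notin> (\<Union>k\<in>?K. branch T k i)"
    using branch_avoids no_loop by fast
  moreover have "finite (\<Union>k\<in>?K. branch T k i)"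
    using fin fin_branch by (intro finite_UN_I) simp_all
  ultimately show ?thesis
    unfolding branch_decomp[OF assms] by simp
qed

end


section \<open>Selective flooding on a tree\<close>

lemma sent_until_0 [simp]: "sent_until \<tau> 0 i j = {}"
  by (simp add: sent_until_def)

lemma sent_until_Suc: "sent_until \<tau> (Suc t) i j = sent_until \<tau> t i j \<union> set_option (\<tau> (Suc t) i j)"
  by (auto simp: sent_until_def atLeastAtMostSuc_conv)

context undirected_tree_digraph
begin

lemma knowledge_eq:
  assumes run: "dsf_run und T S \<tau> I" and "i \<in> pverts T" and "t \<le> card (pverts T) - 1"
  shows "I t i = insert (S i) (\<Union>k\<in>{k. (k, i) \<in> parcs T}. sent_until \<tau> t k i)"
  using assms(3)
proof (induction t)
  case 0
  then show ?case using run assms(2) by (simp add: dsf_run_def)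
next
  case (Suc t)
  have "I (Suc t) i = I t i \<union> {e. \<exists>j. (j, i) \<in> parcs T \<and> \<tau> (Suc t) j i = Some e}"
    using run assms(2) Suc.prems by (simp add: dsf_run_def)
  then show ?case
    using Suc by (auto simp: sent_until_Suc)
qed

lemma dsf_run_selects:
  assumes "dsf_run und T S \<tau> I" "(i, j) \<in> parcs T" "t < card (pverts T) - 1"
  shows "\<tau> (Suc t) i j = Some e \<Longrightarrow> e \<in> selectable und \<tau> I t i j"
    and "\<tau> (Suc t) i j = None \<Longrightarrow> selectable und \<tau> I t i j = {}"
proof -
  have "case \<tau> (Suc t) i j of None \<Rightarrow> selectable und \<tau> I t i j = {}
      | Some e \<Rightarrow> e \<in> selectable und \<tau> I t i j"
    using assms unfolding dsf_run_def by blast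
  then show "\<tau> (Suc t) i j = Some e \<Longrightarrow> e \<in> selectable und \<tau> I t i j"
    and "\<tau> (Suc t) i j = None \<Longrightarrow> selectable und \<tau> I t i j = {}"
    by simp_all
qed

text \<open>
  Messages from the far side of an edge can have reached \<open>i\<close> only through \<open>j\<close>, so that the rule
  never sends them back to \<open>j\<close>.
\<close>

lemma sent_until_subset_branch:
  assumes run: "dsf_run True T S \<tau> I"
  shows "(i, j) \<in> parcs T \<Longrightarrow> t \<le> card (pverts T) - 1 \<Longrightarrow> sent_until \<tau> t i j \<subseteq> S ` branch T i j"
proof (induction t arbitrary: i j)
  case (Suc t)
  have "e \<in> S ` branch T i j" if "\<tau> (Suc t) i j = Some e" for e
  proof -
    have "e \<in> selectable True \<tau> I t i j"
      using dsf_run_selects(1)[OF run] Suc.prems that by auto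
    moreover have "I t i = insert (S i) (\<Union>k\<in>{k. (k, i) \<in> parcs T}. sent_until \<tau> t k i)"
      using knowledge_eq[OF run in_arcsD1[OF Suc.prems(1)]] Suc.prems by simp
    ultimately consider "e = S i" | k where "(k, i) \<in> parcs T" "k \<noteq> j" "e \<in> sent_until \<tau> t k i"
      by (auto simp: selectable_def)
    then show ?thesis
    proof cases
      case 1
      then show ?thesis by (simp add: branch_refl)
    next
      case 2
      then have "e \<in> S ` branch T k i"
        using Suc.IH[of k i] Suc.prems by auto
      then show ?thesis
        using branch_decomp[OF Suc.prems(1)] 2 by blast
    qed
  qed
  then show ?case
    using Suc by (auto simp: sent_until_Suc)
qed simp

text \<open>
  No node stays silent before it has passed on its whole branch. If \<open>i\<close> has nothing to select
  for \<open>j\<close> in round \<open>t + 1\<close>, then it has sent to \<open>j\<close> its own message and everything that came in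
  from the other neighbours \<open>k\<close>. Either some \<open>k\<close> has delivered \<open>t\<close> messages, so that \<open>i\<close> has
  sent at least \<open>t + 1\<close>, or every \<open>k\<close> has delivered its whole branch, so that \<open>i\<close> has sent all
  messages of its own branch.
\<close>

lemma card_sent_until:
  assumes run: "dsf_run True T S \<tau> I" and inj: "inj_on S (pverts T)"
  shows "(i, j) \<in> parcs T \<Longrightarrow> t \<le> card (pverts T) - 1 \<Longrightarrow>
    min t (card (branch T i j)) \<le> card (sent_until \<tau> t i j)"
proof (induction t arbitrary: i j)
  case (Suc t)
  have ij: "i \<in> pverts T" "j \<in> pverts T"
    using Suc.prems by (auto dest: wellformed')
  have fin: "finite (sent_until \<tau> s k l)" if "(k, l) \<in> parcs T" "s \<le> card (pverts T) - 1" for s k l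
    using sent_until_subset_branch[OF run that] finite_branch that finite_subset
    by (metis finite_imageI in_arcsD1)
  show ?case
  proof (cases "\<tau> (Suc t) i j")
    case (Some e)
    then have "e \<notin> sent_until \<tau> t i j"
      using dsf_run_selects(1)[OF run Suc.prems(1), of t e] Suc.prems by (auto simp: selectable_def)
    then have "card (sent_until \<tau> (Suc t) i j) = Suc (card (sent_until \<tau> t i j))"
      using Some fin[OF Suc.prems(1), of t] Suc.prems by (simp add: sent_until_Suc)
    then show ?thesis
      using Suc.IH[OF Suc.prems(1)] Suc.prems by simp
  next
    case None
    let ?K = "{k. (k, i) \<in> parcs T} - {j}"
    let ?A = "\<Union>k\<in>?K. sent_until \<tau> t k i"
    have t: "t \<le> card (pverts T) - 1"
      using Suc.prems by simp
    have finK: "finite ?K"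
      by (rule finite_subset[OF _ finite_vertices]) (auto dest: wellformed')
    have sub: "sent_until \<tau> t k i \<subseteq> S ` branch T k i" if "(k, i) \<in> parcs T" for k
      using sent_until_subset_branch[OF run that t] .
    have bsub: "branch T k l \<subseteq> pverts T" if "(k, l) \<in> parcs T" for k l
      using branch_subset that by (auto dest: wellformed')
    have disjS: "S ` X \<inter> S ` Y = {}" if "X \<inter> Y = {}" "X \<subseteq> pverts T" "Y \<subseteq> pverts T" for X Y
      using that inj by (metis image_empty inj_on_image_Int)
    have "selectable True \<tau> I t i j = {}"
      using dsf_run_selects(2)[OF run Suc.prems(1) _ None] Suc.prems by simp
    then have "insert (S i) ?A \<subseteq> sent_until \<tau> t i j \<union> sent_until \<tau> t j i"
      using knowledge_eq[OF run ij(1) t] by (auto simp: selectable_def)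
    moreover have "insert (S i) ?A \<subseteq> S ` branch T i j"
      using sub branch_decomp[OF Suc.prems(1)] by blast
    moreover have "S ` branch T i j \<inter> sent_until \<tau> t j i = {}"
      using disjS[OF branch_opposite_disjoint[OF Suc.prems(1)]] bsub arc_sym Suc.prems sub[of j]
      by blast
    ultimately have "insert (S i) ?A \<subseteq> sent_until \<tau> t i j"
      by blast
    then have "card (insert (S i) ?A) \<le> card (sent_until \<tau> t i j)"
      using fin Suc.prems t by (intro card_mono) auto
    moreover have "card (insert (S i) ?A) = Suc (\<Sum>k\<in>?K. card (sent_until \<tau> t k i))"
    proof -
      have "S i \<notin> ?A"
      proof
        assume "S i \<in> ?A"
        then obtain k where k: "(k, i) \<in> parcs T" "S i \<in> S ` branch T k i"
          using sub by blast
        then have "i \<in> branch T k i"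
          using inj bsub ij by (metis inj_on_image_mem_iff)
        then show False
          using branch_avoids no_loop k by metis
      qed
      moreover have "card ?A = (\<Sum>k\<in>?K. card (sent_until \<tau> t k i))"
      proof (intro card_UN_disjoint finK ballI impI)
        fix k k' assume k: "k \<in> ?K" "k' \<in> ?K" "k \<noteq> k'"
        then have arcs: "(k, i) \<in> parcs T" "(k', i) \<in> parcs T"
          by simp_all
        have "S ` branch T k i \<inter> S ` branch T k' i = {}"
          by (rule disjS[OF branches_disjoint[OF arcs[THEN arc_sym] k(3)]
                bsub[OF arcs(1)] bsub[OF arcs(2)]])
        then show "sent_until \<tau> t k i \<inter> sent_until \<tau> t k' i = {}"
          using sub[OF arcs(1)] sub[OF arcs(2)] by blast
      next
        fix k assume "k \<in> ?K"
        then show "finite (sent_until \<tau> t k i)"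
          using fin[OF _ t] by simp
      qed
      moreover have "finite ?A"
        using finK fin[OF _ t] by (intro finite_UN_I) simp_all
      ultimately show ?thesis by simp
    qed
    moreover have "min (Suc t) (card (branch T i j)) \<le> Suc (\<Sum>k\<in>?K. card (sent_until \<tau> t k i))"
    proof (cases "\<exists>k\<in>?K. t \<le> card (branch T k i)")
      case True
      then obtain k where k: "k \<in> ?K" "t \<le> card (branch T k i)" by blast
      then have "t \<le> card (sent_until \<tau> t k i)"
        using Suc.IH[of k i] t by auto
      also have "\<dots> \<le> (\<Sum>k\<in>?K. card (sent_until \<tau> t k i))"
        using k finK by (intro member_le_sum) auto
      finally show ?thesis by simp
    next
      case False
      then have "card (branch T k i) \<le> card (sent_until \<tau> t k i)" if "k \<in> ?K" for k
        using Suc.IH[of k i] t that by force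
      then have "(\<Sum>k\<in>?K. card (branch T k i)) \<le> (\<Sum>k\<in>?K. card (sent_until \<tau> t k i))"
        by (rule sum_mono)
      then show ?thesis
        using card_branch[OF Suc.prems(1)] by simp
    qed
    ultimately show ?thesis
      using None by (simp add: sent_until_Suc)
  qed
qed simp

theorem dsf_run_complete:
  assumes run: "dsf_run True T S \<tau> I" and inj: "inj_on S (pverts T)" and i: "i \<in> pverts T"
  shows "I (card (pverts T) - 1) i = S ` pverts T"
proof -
  let ?N = "card (pverts T) - 1"
  have "sent_until \<tau> ?N k i = S ` branch T k i" if k: "(k, i) \<in> parcs T" for k
  proof -
    have sub: "branch T k i \<subseteq> pverts T - {i}"
      using branch_subset[of k i] branch_avoids no_loop k by (fastforce dest: wellformed')
    then have "card (branch T k i) \<le> ?N"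
      using card_mono[OF _ sub] finite_vertices i by simp
    moreover have "card (S ` branch T k i) = card (branch T k i)"
      using sub inj by (intro card_image) (auto intro: inj_on_subset)
    ultimately have "card (S ` branch T k i) \<le> card (sent_until \<tau> ?N k i)"
      using card_sent_until[OF run inj k, of ?N] by simp
    moreover have "finite (S ` branch T k i)"
      using sub finite_vertices finite_subset by (metis finite_Diff finite_imageI)
    ultimately show ?thesis
      using sent_until_subset_branch[OF run k, of ?N] card_seteq by blast
  qed
  then have "I ?N i = insert (S i) (\<Union>k\<in>{k. (k, i) \<in> parcs T}. S ` branch T k i)"
    using knowledge_eq[OF run i, of ?N] by simp
  also have "\<dots> = S ` pverts T"
    by (subst vertices_decomp[OF i]) blast
  finally show ?thesis .
qed

end

section \<open>Gradients and Hessians\<close>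

lemma GDERIV_unique:
  assumes "GDERIV f x :> D" "GDERIV f x :> D'"
  shows "D = D'"
proof -
  have "(\<lambda>h. h \<bullet> D) = (\<lambda>h. h \<bullet> D')"
    using assms has_derivative_unique unfolding gderiv_def by blast
  then have "h \<bullet> D = h \<bullet> D'" for h
    by metis
  then show ?thesis
    using inner_eq_zero_iff[of "D - D'"] by (simp add: inner_diff_right)
qed

lemma grad_eq: "GDERIV f x :> D \<Longrightarrow> grad f x = D"
  unfolding grad_def using GDERIV_unique by blast

lemma grad_works:
  fixes f :: "real^'p \<Rightarrow> real"
  assumes "f differentiable (at x)"
  shows "GDERIV f x :> grad f x"
proof -
  obtain F where F: "(f has_derivative F) (at x)"
    using assms by (auto simp: differentiable_def)
  then have "linear F"
    by (rule has_derivative_linear)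
  then have "F = (\<lambda>h. h \<bullet> adjoint F 1)"
    by (auto simp: adjoint_works)
  then have "GDERIV f x :> adjoint F 1"
    using F by (simp add: gderiv_def)
  then show ?thesis
    using grad_eq by metis
qed

lemma hess_works:
  "grad f differentiable (at x) \<Longrightarrow> (grad f has_derivative (*v) (hess f x)) (at x)"
  unfolding hess_def using jacobian_works by blast

lemma hess_eq:
  assumes "(grad f has_derivative (*v) A) (at x)"
  shows "hess f x = A"
  unfolding hess_def jacobian_def frechet_derivative_at[OF assms, symmetric]
  by (rule matrix_of_matrix_vector_mul)

lemma sum_matrix_vector_mult: "(\<Sum>i\<in>A. M i) *v v = (\<Sum>i\<in>A. M i *v v)"
  by (induction A rule: infinite_finite_induct) (simp_all add: matrix_vector_mult_add_rdistrib)

lemma grad_sum: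
  assumes "\<forall>i\<in>A. fl i differentiable (at y)"
  shows "grad (\<lambda>y. \<Sum>i\<in>A. fl i y) y = (\<Sum>i\<in>A. grad (fl i) y)"
proof (rule grad_eq)
  have "((\<lambda>y. \<Sum>i\<in>A. fl i y) has_derivative (\<lambda>h. \<Sum>i\<in>A. h \<bullet> grad (fl i) y)) (at y)"
    using assms grad_works by (intro has_derivative_sum) (auto simp: gderiv_def)
  then show "GDERIV (\<lambda>y. \<Sum>i\<in>A. fl i y) y :> (\<Sum>i\<in>A. grad (fl i) y)"
    by (simp add: gderiv_def inner_sum_right)
qed

lemma hess_sum:
  assumes "\<forall>i\<in>A. twice_differentiable (fl i)"
  shows "hess (\<lambda>y. \<Sum>i\<in>A. fl i y) y = (\<Sum>i\<in>A. hess (fl i) y)"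
proof (rule hess_eq)
  have "grad (\<lambda>y. \<Sum>i\<in>A. fl i y) = (\<lambda>y. \<Sum>i\<in>A. grad (fl i) y)"
    using assms by (intro ext grad_sum) (auto simp: twice_differentiable_def)
  moreover have "((\<lambda>y. \<Sum>i\<in>A. grad (fl i) y) has_derivative (\<lambda>v. \<Sum>i\<in>A. hess (fl i) y *v v)) (at y)"
    using assms by (intro has_derivative_sum hess_works) (auto simp: twice_differentiable_def)
  ultimately show "(grad (\<lambda>y. \<Sum>i\<in>A. fl i y) has_derivative (*v) (\<Sum>i\<in>A. hess (fl i) y)) (at y)"
    by (simp add: sum_matrix_vector_mult[abs_def])
qed


section \<open>Strong convexity and the damped Newton step\<close>

lemma norm_matrix_vector_le: "norm (A *v v) \<le> spectral_norm A * norm (v :: real^'p)"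
  unfolding spectral_norm_def by (rule onorm) (simp add: matrix_vector_mul_bounded_linear)

text \<open>
  A vector field \<open>g\<close> with a uniformly positive definite, Lipschitz continuous Jacobian \<open>H\<close>. In the
  application, \<open>g\<close> is the gradient and \<open>H\<close> the Hessian of a strongly convex function; symmetry
  of \<open>H\<close> plays no role.
\<close>

locale strongly_monotone_field =
  fixes g :: "real^'p \<Rightarrow> real^'p" and H :: "real^'p \<Rightarrow> real^'p^'p" and \<mu> L :: real
  assumes deriv: "\<And>y. (g has_derivative (*v) (H y)) (at y)"
    and mu_pos: "\<mu> > 0" and L_pos: "L > 0"
    and coercive: "\<And>y v. \<mu> * (v \<bullet> v) \<le> v \<bullet> (H y *v v)"
    and lipschitz: "\<And>y z. spectral_norm (H y - H z) \<le> L * norm (y - z)"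
begin

lemma deriv_along_line:
  "((\<lambda>t. g (y + t *\<^sub>R d) \<bullet> u) has_real_derivative (H (y + t *\<^sub>R d) *v d) \<bullet> u) (at t)"
proof -
  have "((\<lambda>t. y + t *\<^sub>R d) has_derivative (\<lambda>h. h *\<^sub>R d)) (at t)"
    by (auto intro!: derivative_eq_intros)
  then have "((\<lambda>t. g (y + t *\<^sub>R d)) has_derivative (\<lambda>h. H (y + t *\<^sub>R d) *v (h *\<^sub>R d))) (at t)"
    using deriv[of "y + t *\<^sub>R d"] by (rule has_derivative_compose)
  then have "((\<lambda>t. g (y + t *\<^sub>R d) \<bullet> u) has_derivative (\<lambda>h. (H (y + t *\<^sub>R d) *v (h *\<^sub>R d)) \<bullet> u)) (at t)"
    by (rule has_derivative_inner_left)
  then show ?thesis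
    by (simp add: has_field_derivative_def matrix_vector_mult_scaleR mult_commute_abs)
qed

lemma strongly_monotone: "\<mu> * (norm d)\<^sup>2 \<le> (g (y + d) - g y) \<bullet> d"
proof -
  let ?h = "\<lambda>t. g (y + t *\<^sub>R d) \<bullet> d - \<mu> * (norm d)\<^sup>2 * t"
  have "?h 0 \<le> ?h 1"
  proof (rule DERIV_nonneg_imp_nondecreasing[where f = ?h])
    fix t :: real
    have "(?h has_real_derivative
        (H (y + t *\<^sub>R d) *v d) \<bullet> d - \<mu> * (norm d)\<^sup>2) (at t)"
      by (auto intro!: derivative_eq_intros deriv_along_line)
    moreover have "(H (y + t *\<^sub>R d) *v d) \<bullet> d - \<mu> * (norm d)\<^sup>2 \<ge> 0"
      using coercive[of d "y + t *\<^sub>R d"] by (simp add: power2_norm_eq_inner inner_commute)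
    ultimately show "\<exists>D. (?h has_real_derivative D) (at t) \<and> 0 \<le> D"
      by blast
  qed simp
  then show ?thesis
    by (simp add: inner_diff_left)
qed

lemma norm_diff_le: "\<mu> * norm (z - y) \<le> norm (g z - g y)"
proof (cases "z = y")
  case False
  have "\<mu> * (norm (z - y))\<^sup>2 \<le> (g z - g y) \<bullet> (z - y)"
    using strongly_monotone[of "z - y" y] by simp
  also have "\<dots> \<le> norm (g z - g y) * norm (z - y)"
    by (rule norm_cauchy_schwarz)
  finally have "\<mu> * norm (z - y) * norm (z - y) \<le> norm (g z - g y) * norm (z - y)"
    by (simp add: power2_eq_square)
  then show ?thesis
    using False by simp
qed simp

text \<open>Compares the derivatives along the segment, projected onto the error \<open>u\<close> itself.\<close>

lemma linearization_error: "norm (g (y + d) - g y - H y *v d) \<le> L / 2 * (norm d)\<^sup>2"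
proof -
  define u where "u = g (y + d) - g y - H y *v d"
  define c where "c = L / 2 * (norm d)\<^sup>2 * norm u"
  let ?h = "\<lambda>t. g (y + t *\<^sub>R d) \<bullet> u - t * ((H y *v d) \<bullet> u) - c * t\<^sup>2"
  have "?h 1 \<le> ?h 0"
  proof (rule DERIV_nonpos_imp_nonincreasing[where f = ?h])
    fix t :: real assume t: "0 \<le> t" "t \<le> 1"
    have "(?h has_real_derivative
        ((H (y + t *\<^sub>R d) *v d) \<bullet> u - (H y *v d) \<bullet> u - c * (2 * t))) (at t)"
      by (auto intro!: derivative_eq_intros deriv_along_line)
    moreover have "(H (y + t *\<^sub>R d) *v d) \<bullet> u - (H y *v d) \<bullet> u \<le> c * (2 * t)"
    proof -
      have "(H (y + t *\<^sub>R d) *v d) \<bullet> u - (H y *v d) \<bullet> u = ((H (y + t *\<^sub>R d) - H y) *v d) \<bullet> u"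
        by (simp add: matrix_vector_mult_diff_rdistrib inner_diff_left)
      also have "\<dots> \<le> norm ((H (y + t *\<^sub>R d) - H y) *v d) * norm u"
        by (rule norm_cauchy_schwarz)
      also have "\<dots> \<le> (spectral_norm (H (y + t *\<^sub>R d) - H y) * norm d) * norm u"
        by (intro mult_right_mono norm_matrix_vector_le) simp
      also have "\<dots> \<le> ((L * norm (y + t *\<^sub>R d - y)) * norm d) * norm u"
        by (intro mult_right_mono lipschitz) simp_all
      also have "\<dots> = c * (2 * t)"
        using t by (simp add: c_def power2_eq_square)
      finally show ?thesis .
    qed
    ultimately show "\<exists>D. (?h has_real_derivative D) (at t) \<and> D \<le> 0"
      by (meson diff_le_0_iff_le)
  qed simp
  then have "u \<bullet> u \<le> c"
    by (simp add: u_def inner_diff_left)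
  then have "norm u * norm u \<le> (L / 2 * (norm d)\<^sup>2) * norm u"
    by (simp add: c_def dot_square_norm power2_eq_square)
  then have "norm u \<le> L / 2 * (norm d)\<^sup>2"
    using L_pos by (cases "u = 0") simp_all
  then show ?thesis
    by (simp add: u_def)
qed

lemma norm_ge: "\<mu> * norm v \<le> norm (H y *v v)"
proof (cases "v = 0")
  case False
  have "\<mu> * (norm v * norm v) \<le> norm v * norm (H y *v v)"
    using coercive[of v y] norm_cauchy_schwarz[of v "H y *v v"]
    by (simp add: dot_square_norm power2_eq_square)
  then have "norm v * (\<mu> * norm v) \<le> norm v * norm (H y *v v)"
    by (simp add: algebra_simps)
  then show ?thesis
    using False by simp
qed simp

lemma mult_matrix_inv: "H y *v (matrix_inv (H y) *v v) = v"
proof -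
  have "v = 0" if "H y *v v = 0" for v
    using norm_ge[of v y] mu_pos that by (simp add: mult_le_0_iff)
  then have "\<exists>B. B ** H y = mat 1"
    by (subst matrix_left_invertible_ker) blast
  then have "invertible (H y)"
    by (simp add: invertible_left_inverse)
  then have "H y ** matrix_inv (H y) = mat 1"
    unfolding invertible_def matrix_inv_def by (rule someI2_ex) blast
  then show ?thesis
    by (simp add: matrix_vector_mul_assoc)
qed

lemma newton_step_norm:
  assumes "0 \<le> \<alpha>" "\<alpha> \<le> 1"
  shows "norm (g (y - \<alpha> *\<^sub>R (matrix_inv (H y) *v g y)))
    \<le> (1 - \<alpha>) * norm (g y) + L / (2 * \<mu>\<^sup>2) * (\<alpha> * norm (g y))\<^sup>2"
proof -
  define w where "w = matrix_inv (H y) *v g y"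
  define d where "d = - \<alpha> *\<^sub>R w"
  have Hw: "H y *v w = g y"
    by (simp add: w_def mult_matrix_inv)
  have "norm w \<le> norm (g y) / \<mu>"
    using norm_ge[of w y] Hw mu_pos by (simp add: pos_le_divide_eq mult.commute)
  then have "norm d \<le> \<alpha> * (norm (g y) / \<mu>)"
    using assms mult_left_mono[of "norm w" "norm (g y) / \<mu>" \<alpha>] by (simp add: d_def)
  then have "(norm d)\<^sup>2 \<le> (\<alpha> * (norm (g y) / \<mu>))\<^sup>2"
    by (intro power_mono) simp_all
  then have "L / 2 * (norm d)\<^sup>2 \<le> L / 2 * (\<alpha> * (norm (g y) / \<mu>))\<^sup>2"
    using L_pos by simp
  also have "\<dots> = L / (2 * \<mu>\<^sup>2) * (\<alpha> * norm (g y))\<^sup>2"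
    by (simp add: power_divide power_mult_distrib)
  finally have d: "L / 2 * (norm d)\<^sup>2 \<le> L / (2 * \<mu>\<^sup>2) * (\<alpha> * norm (g y))\<^sup>2" .
  have Hd: "H y *v d = - \<alpha> *\<^sub>R g y"
    unfolding d_def by (simp add: matrix_vector_mult_scaleR Hw flip: scaleR_minus_left)
  have "g (y + d) = (1 - \<alpha>) *\<^sub>R g y + (g (y + d) - g y - H y *v d)"
    unfolding Hd by (simp add: algebra_simps)
  then have "norm (g (y + d)) \<le> norm ((1 - \<alpha>) *\<^sub>R g y) + norm (g (y + d) - g y - H y *v d)"
    by (metis norm_triangle_ineq)
  then have "norm (g (y + d)) \<le> (1 - \<alpha>) * norm (g y) + L / 2 * (norm d)\<^sup>2"
    using linearization_error[of y d] assms by simp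
  then show ?thesis
    using d by (simp add: d_def w_def)
qed

text \<open>
  In terms of the scaled gradient norm \<open>s\<close>, the step length is \<open>min 1 (1 / s)\<close> and the previous
  bound reads \<open>(1 - \<alpha>) * s + (\<alpha> * s)\<^sup>2 / 2\<close>.
\<close>

lemma dan_step:
  fixes y :: "real^'p"
  defines "s \<equiv> L / \<mu>\<^sup>2 * norm (g y)"
    and "s' \<equiv> L / \<mu>\<^sup>2 * norm (g (y - dan_stepsize \<mu> L (g y) *\<^sub>R (matrix_inv (H y) *v g y)))"
  shows "1 \<le> s \<Longrightarrow> s' \<le> s - 1/2" and "s \<le> 1 \<Longrightarrow> s' \<le> s\<^sup>2 / 2"
proof -
  define \<alpha> where "\<alpha> = dan_stepsize \<mu> L (g y)"
  have alpha: "\<alpha> = min 1 (1 / s)"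
    by (simp add: \<alpha>_def dan_stepsize_def s_def)
  have "0 \<le> s"
    using L_pos by (simp add: s_def)
  then have "0 \<le> \<alpha>" "\<alpha> \<le> 1"
    by (auto simp: alpha)
  then have "norm (g (y - \<alpha> *\<^sub>R (matrix_inv (H y) *v g y)))
    \<le> (1 - \<alpha>) * norm (g y) + L / (2 * \<mu>\<^sup>2) * (\<alpha> * norm (g y))\<^sup>2"
    by (rule newton_step_norm)
  then have "s' \<le> L / \<mu>\<^sup>2 * ((1 - \<alpha>) * norm (g y) + L / (2 * \<mu>\<^sup>2) * (\<alpha> * norm (g y))\<^sup>2)"
    unfolding s'_def \<alpha>_def[symmetric] using L_pos by (intro mult_left_mono) simp_all
  also have "\<dots> = (1 - \<alpha>) * s + (\<alpha> * s)\<^sup>2 / 2"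
    by (simp add: s_def distrib_left power_mult_distrib power2_eq_square mult_ac)
  finally have le: "s' \<le> (1 - \<alpha>) * s + (\<alpha> * s)\<^sup>2 / 2" .
  show "s' \<le> s - 1/2" if "1 \<le> s"
  proof -
    have "\<alpha> * s = 1" using that by (simp add: alpha min_def)
    then show ?thesis using le by (simp add: algebra_simps)
  qed
  show "s' \<le> s\<^sup>2 / 2" if "s \<le> 1"
  proof (cases "s = 0")
    case True
    then show ?thesis using le by simp
  next
    case False
    then have "\<alpha> = 1" using that \<open>0 \<le> s\<close> by (simp add: alpha)
    then show ?thesis using le by simp
  qed
qed

text \<open>A potential of \<open>g\<close> grows at least quadratically away from any zero of \<open>g\<close>.\<close>

lemma potential_ge:
  assumes pot: "\<And>y. GDERIV f y :> g y" and zero: "g z = 0"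
  shows "f z + \<mu> / 2 * (norm (y - z))\<^sup>2 \<le> f y"
proof -
  define d where "d = y - z"
  let ?h = "\<lambda>t. f (z + t *\<^sub>R d) - \<mu> / 2 * (norm d)\<^sup>2 * t\<^sup>2"
  have "?h 0 \<le> ?h 1"
  proof (rule DERIV_nonneg_imp_nondecreasing[where f = ?h])
    fix t :: real assume t: "0 \<le> t" "t \<le> 1"
    have "((\<lambda>t. z + t *\<^sub>R d) has_derivative (\<lambda>h. h *\<^sub>R d)) (at t)"
      by (auto intro!: derivative_eq_intros)
    then have "((\<lambda>t. f (z + t *\<^sub>R d)) has_derivative (\<lambda>h. (h *\<^sub>R d) \<bullet> g (z + t *\<^sub>R d))) (at t)"
      using pot[of "z + t *\<^sub>R d", unfolded gderiv_def] by (rule has_derivative_compose)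
    then have "((\<lambda>t. f (z + t *\<^sub>R d)) has_real_derivative d \<bullet> g (z + t *\<^sub>R d)) (at t)"
      by (simp add: has_field_derivative_def mult_commute_abs)
    then have "(?h has_real_derivative d \<bullet> g (z + t *\<^sub>R d) - \<mu> * (norm d)\<^sup>2 * t) (at t)"
      by (auto intro!: derivative_eq_intros)
    moreover have "\<mu> * (norm d)\<^sup>2 * t \<le> d \<bullet> g (z + t *\<^sub>R d)"
    proof (cases "t = 0")
      case False
      have "t * (\<mu> * (norm d)\<^sup>2 * t) \<le> t * (d \<bullet> g (z + t *\<^sub>R d))"
        using strongly_monotone[of "t *\<^sub>R d" z] zero
        by (simp add: power_mult_distrib inner_commute power2_eq_square ac_simps)
      then show ?thesis using t False by simp
    qed (simp add: zero)
    ultimately show "\<exists>D. (?h has_real_derivative D) (at t) \<and> 0 \<le> D"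
      by (meson diff_ge_0_iff_ge)
  qed simp
  then show ?thesis
    by (simp add: d_def)
qed

lemma minimizer_iff:
  assumes pot: "\<And>y. GDERIV f y :> g y" and zero: "g xs = 0"
  shows "(\<forall>y. f z \<le> f y) \<longleftrightarrow> z = xs"
proof
  assume "\<forall>y. f z \<le> f y"
  then have "\<mu> / 2 * (norm (z - xs))\<^sup>2 \<le> 0"
    using potential_ge[OF pot zero, of z] by (metis add_le_same_cancel1 order_trans)
  then show "z = xs"
    using mu_pos by (simp add: mult_le_0_iff)
next
  assume "z = xs"
  then show "\<forall>y. f z \<le> f y"
    using potential_ge[OF pot zero] mu_pos
    by (smt (verit) divide_nonneg_nonneg mult_nonneg_nonneg zero_le_power2)
qed

text \<open>
  By strong monotonicity the points form a Cauchy sequence, so that the existence of a zero of \<open>g\<close>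
  need not be known beforehand.
\<close>

lemma converges_to_zero:
  assumes "(\<lambda>k. norm (g (x k))) \<longlonglongrightarrow> 0"
  obtains xs where "x \<longlonglongrightarrow> xs" "g xs = 0"
proof -
  have "Cauchy x"
  proof (rule metric_CauchyI)
    fix e :: real assume e: "0 < e"
    then have "\<forall>\<^sub>F k in sequentially. norm (g (x k)) < \<mu> * e / 2"
      using mu_pos by (intro order_tendstoD(2)[OF assms]) simp
    then obtain N where N: "\<And>k. k \<ge> N \<Longrightarrow> norm (g (x k)) < \<mu> * e / 2"
      by (auto simp: eventually_sequentially)
    have "dist (x m) (x k) < e" if "m \<ge> N" "k \<ge> N" for m k
    proof -
      have "\<mu> * norm (x m - x k) \<le> norm (g (x m)) + norm (g (x k))"
        using norm_diff_le[of "x m" "x k"] norm_triangle_ineq4[of "g (x m)" "g (x k)"] by linarith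
      also have "\<dots> < \<mu> * e"
        using N[OF that(1)] N[OF that(2)] by linarith
      finally show ?thesis
        using mu_pos by (simp add: dist_norm)
    qed
    then show "\<exists>M. \<forall>m\<ge>M. \<forall>n\<ge>M. dist (x m) (x n) < e"
      by blast
  qed
  then obtain xs where xs: "x \<longlonglongrightarrow> xs"
    using Cauchy_convergent_iff convergent_def by blast
  have "isCont g xs"
    using deriv has_derivative_continuous by blast
  then have "(\<lambda>k. g (x k)) \<longlonglongrightarrow> g xs"
    using xs isCont_tendsto_compose by blast
  moreover have "(\<lambda>k. g (x k)) \<longlonglongrightarrow> 0"
    using assms tendsto_norm_zero_iff by blast
  ultimately have "g xs = 0"
    using LIMSEQ_unique by blast
  with xs that show ?thesis by blast
qed

end


section \<open>The scaled gradient norms\<close>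

text \<open>
  \<open>s k\<close> stands for \<open>L / \<mu>\<^sup>2\<close> times the gradient norm at the iterate number \<open>k\<close>. A damped step
  lowers it by at least \<open>1/2\<close>. A full step leads to at most half its square, so that \<open>s k / 2\<close>
  is replaced by at most its square.
\<close>

locale damped_newton_rate =
  fixes s :: "nat \<Rightarrow> real" and k0 :: nat and \<gamma> :: real
  assumes nonneg: "\<And>k. 0 \<le> s k"
    and damped: "\<And>k. 1 \<le> s k \<Longrightarrow> s (Suc k) \<le> s k - 1/2"
    and pure: "\<And>k. s k \<le> 1 \<Longrightarrow> s (Suc k) \<le> (s k)\<^sup>2 / 2"
    and k0_def: "k0 = nat (max 0 (\<lceil>2 * s 0\<rceil> - 2))"
    and gamma_def: "\<gamma> = s 0 / 2 - real k0 / 4"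
begin

lemma decseq_s: "decseq s"
proof (rule decseq_SucI)
  fix k
  show "s (Suc k) \<le> s k"
  proof (cases "1 \<le> s k")
    case False
    then have "s k * s k \<le> 1 * s k"
      using nonneg by (intro mult_right_mono) auto
    then show ?thesis
      using pure[of k] False nonneg[of k] by (simp add: power2_eq_square)
  qed (use damped in force)
qed

lemma gamma_cases:
  obtains "k0 = 0" "0 \<le> s 0" "s 0 \<le> 1" "\<gamma> = s 0 / 2"
  | "k0 > 0" "1/4 < \<gamma>" "\<gamma> \<le> 1/2"
proof -
  define c where "c = \<lceil>2 * s 0\<rceil>"
  have c: "of_int c - 1 < 2 * s 0" "2 * s 0 \<le> of_int c"
    unfolding c_def using ceiling_correct[of "2 * s 0"] by blast+
  show thesis
  proof (cases "c \<le> 2")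
    case True
    then have "k0 = 0"
      by (simp add: k0_def flip: c_def)
    moreover have "real_of_int c \<le> 2"
      using True by simp
    ultimately show thesis
      using that(1) nonneg[of 0] c gamma_def by simp
  next
    case False
    then have "real k0 = of_int c - 2" "k0 > 0"
      by (simp_all add: k0_def flip: c_def)
    then show thesis
      using that(2) c unfolding gamma_def by linarith
  qed
qed

lemma gamma_nonneg: "0 \<le> \<gamma>"
  by (rule gamma_cases) simp_all

lemma gamma_le: "\<gamma> \<le> 1/2"
  by (rule gamma_cases) simp_all

lemma gamma_gt: "k0 > 0 \<Longrightarrow> \<gamma> > 1/4"
  by (rule gamma_cases) simp_all

text \<open>\<open>\<gamma> = 1/2\<close> forces \<open>2 * s 0 = k0 + 2\<close>, which is an integer and at least \<open>2\<close>.\<close>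

lemma gamma_less:
  assumes "\<not> (2 * s 0 \<in> \<int> \<and> 2 * s 0 \<ge> 2)"
  shows "\<gamma> < 1/2"
proof (rule ccontr)
  assume "\<not> \<gamma> < 1/2"
  then have half: "\<gamma> = 1/2"
    using gamma_le by simp
  then have "2 * s 0 = of_int (int k0 + 2)"
    using gamma_def by simp
  then show False
    using assms by (metis Ints_of_int of_int_0_le_iff of_int_add of_int_numeral of_int_of_nat_eq le_add_same_cancel2 of_nat_0_le_iff)
qed

lemma damped_phase: "k \<le> k0 \<Longrightarrow> s k \<le> s 0 - real k / 2"
proof (induction k)
  case (Suc k)
  show ?case
  proof (cases "1 \<le> s k")
    case True
    then show ?thesis using damped[of k] Suc by (simp add: field_simps)
  next
    case False
    \<comment> \<open>A full step before \<open>k0\<close> leads to at most \<open>1/2\<close>, hence below \<open>2 * \<gamma>\<close>, the bound at \<open>k0\<close>.\<close>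
    then have "(s k)\<^sup>2 \<le> 1"
      using nonneg[of k] by (simp add: power_le_one)
    then have "s (Suc k) \<le> 1/2"
      using pure[of k] False by simp
    moreover have "2 * \<gamma> \<le> s 0 - real (Suc k) / 2"
      using Suc.prems gamma_def by (simp add: field_simps)
    ultimately show ?thesis
      using gamma_gt Suc.prems by simp
  qed
qed simp

lemma pure_phase: "s (k0 + m) \<le> 2 * \<gamma> ^ (2 ^ m)"
proof (induction m)
  case 0
  then show ?case
    using damped_phase[of k0] gamma_def by simp
next
  case (Suc m)
  have "\<gamma> ^ (2 ^ m) \<le> \<gamma> ^ 1"
    using gamma_nonneg gamma_le by (intro power_decreasing) simp_all
  then have "s (k0 + m) \<le> 1"
    using Suc gamma_le by simp
  then have "s (k0 + Suc m) \<le> (s (k0 + m))\<^sup>2 / 2"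
    using pure[of "k0 + m"] by simp
  also have "\<dots> \<le> (2 * \<gamma> ^ (2 ^ m))\<^sup>2 / 2"
    using Suc nonneg by (intro divide_right_mono power_mono) simp_all
  also have "\<dots> = 2 * \<gamma> ^ (2 ^ Suc m)"
    by (simp add: power_mult_distrib power_mult[symmetric] mult.commute)
  finally show ?case .
qed

lemma s_le: "s k \<le> (if k \<le> k0 then s 0 - real k / 2 else 2 * \<gamma> ^ (2 ^ (k - k0)))"
  using damped_phase[of k] pure_phase[of "k - k0"] by (cases "k \<le> k0") simp_all

lemma s_tendsto: "s \<longlonglongrightarrow> 0"
proof -
  have le: "s (m + k0) \<le> 2 * (1/2) ^ m" for m
  proof -
    have "\<gamma> ^ (2 ^ m) \<le> (1/2) ^ (2 ^ m)"
      using gamma_nonneg gamma_le by (intro power_mono)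
    also have "\<dots> \<le> (1/2) ^ m"
      by (intro power_decreasing) (simp_all add: less_imp_le)
    finally show ?thesis
      using pure_phase[of m] by (simp add: add.commute)
  qed
  have lim: "(\<lambda>m. 2 * (1/2 :: real) ^ m) \<longlonglongrightarrow> 0"
    by (auto intro!: tendsto_eq_intros LIMSEQ_power_zero)
  have "(\<lambda>m. s (m + k0)) \<longlonglongrightarrow> 0"
    by (rule tendsto_sandwich[OF always_eventually always_eventually tendsto_const lim])
      (use nonneg le in blast)+
  then show ?thesis
    by (rule LIMSEQ_offset)
qed

lemma s_le_distance_bound:
  "s k \<le> (if k \<le> k0 then real k0 - real k + 2 * \<gamma> / (1 - \<gamma>)
    else 2 * \<gamma> ^ (2 ^ (k - k0)) / (1 - \<gamma> ^ (2 ^ (k - k0))))"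
proof -
  have frac: "2 * q \<le> 2 * q / (1 - q)" if "0 \<le> q" "q \<le> 1/2" for q :: real
    using that by (simp add: pos_le_divide_eq mult_left_le)
  show ?thesis
  proof (cases "k \<le> k0")
    case True
    have "s k \<le> (real k0 - real k) / 2 + 2 * \<gamma>"
      using s_le[of k] True gamma_def by (simp add: field_simps)
    then show ?thesis
      using True frac[OF gamma_nonneg gamma_le] by (simp add: field_simps)
  next
    case False
    have "\<gamma> ^ (2 ^ (k - k0)) \<le> \<gamma> ^ 1"
      using gamma_nonneg gamma_le by (intro power_decreasing) simp_all
    then show ?thesis
      using s_le[of k] False frac[of "\<gamma> ^ (2 ^ (k - k0))"] gamma_nonneg gamma_le by simp
  qed
qed

end

section \<open>The Distributed Adaptive Newton method\<close>

lemma performs_dsf_complete: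
  fixes G T :: "'v pair_pre_digraph"
  assumes fin: "finite (pverts G)" and inj: "inj_on S (pverts G)"
    and tree: "symmetric G \<longrightarrow> undirected_spanning_tree T G"
    and dsf: "performs_dsf G T S Out" and i: "i \<in> pverts G"
  shows "Out i = S ` pverts G"
proof (cases "symmetric G")
  case True
  then have span: "undirected_tree T" "pverts G = pverts T" "wf_digraph (with_proj T)"
    using tree by (auto simp: undirected_spanning_tree_def spanning_def subgraph_def)
  interpret undirected_tree_digraph T
    using span fin by (intro undirected_tree_digraph.intro undirected_tree_digraph_axioms.intro)
      (simp_all add: wf_digraph_wp_iff)
  show ?thesis
    using dsf True dsf_run_complete[of S _ _ i] inj i unfolding performs_dsf_def span(2) by auto
next
  case False
  then show ?thesis
    using dsf i unfolding performs_dsf_def by auto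
qed

lemma dan_update_newton:
  fixes fl :: "nat \<Rightarrow> real^'p \<Rightarrow> real"
  assumes inj: "inj_on ident V" and same: "\<And>u. u \<in> V \<Longrightarrow> y u = z"
    and diff: "\<forall>i\<in>V. twice_differentiable (fl i)"
    and f_def: "f = (\<lambda>y. \<Sum>i\<in>V. fl i y)"
  shows "dan_update \<mu> L (dan_message ident fl y ` V) z
    = z - dan_stepsize \<mu> L (grad f z) *\<^sub>R (matrix_inv (hess f z) *v grad f z)"
proof -
  have inj_msg: "inj_on (dan_message ident fl y) V"
    using inj by (auto simp: inj_on_def dan_message_def)
  have "(\<Sum>(_, gu, _)\<in>dan_message ident fl y ` V. gu) = (\<Sum>u\<in>V. grad (fl u) (y u))"
    by (subst sum.reindex[OF inj_msg]) (simp add: dan_message_def)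
  also have "\<dots> = (\<Sum>u\<in>V. grad (fl u) z)"
    using same by simp
  also have "\<dots> = grad f z"
    unfolding f_def using diff by (intro grad_sum[symmetric]) (auto simp: twice_differentiable_def)
  finally have g: "(\<Sum>(_, gu, _)\<in>dan_message ident fl y ` V. gu) = grad f z" .
  have "(\<Sum>(_, _, Hu)\<in>dan_message ident fl y ` V. Hu) = (\<Sum>u\<in>V. hess (fl u) (y u))"
    by (subst sum.reindex[OF inj_msg]) (simp add: dan_message_def)
  also have "\<dots> = (\<Sum>u\<in>V. hess (fl u) z)"
    using same by simp
  also have "\<dots> = hess f z"
    unfolding f_def using diff by (intro hess_sum[symmetric])
  finally have h: "(\<Sum>(_, _, Hu)\<in>dan_message ident fl y ` V. Hu) = hess f z" .
  show ?thesis
    unfolding dan_update_def g h by (simp add: Let_def)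
qed

text \<open>
  The iterates of all nodes agree, and since flooding delivers all messages, each node performs
  the centralized damped Newton step for \<open>f\<close>.
\<close>

lemma dan_newton:
  fixes fl :: "nat \<Rightarrow> real^'p \<Rightarrow> real"
  assumes dan: "dan G T ident fl \<mu> L x0 x"
    and fin: "finite (pverts G)" and inj: "inj_on ident (pverts G)"
    and tree: "symmetric G \<longrightarrow> undirected_spanning_tree T G"
    and diff: "\<forall>i\<in>pverts G. twice_differentiable (fl i)"
    and f_def: "f = (\<lambda>y. \<Sum>i\<in>pverts G. fl i y)"
    and i: "i \<in> pverts G"
  shows "x i (Suc k)
    = x i k - dan_stepsize \<mu> L (grad f (x i k)) *\<^sub>R (matrix_inv (hess f (x i k)) *v grad f (x i k))"
proof -
  let ?N = "\<lambda>z. z - dan_stepsize \<mu> L (grad f z) *\<^sub>R (matrix_inv (hess f z) *v grad f z)"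
  have step: "x j (Suc k) = ?N (x j k)"
    if same: "\<And>u. u \<in> pverts G \<Longrightarrow> x u k = x j k" and j: "j \<in> pverts G" for j k
  proof -
    let ?S = "dan_message ident fl (\<lambda>u. x u k)"
    obtain Out where Out: "performs_dsf G T ?S Out" "x j (Suc k) = dan_update \<mu> L (Out j) (x j k)"
      using dan j unfolding dan_def by blast
    have "inj_on ?S (pverts G)"
      using inj by (auto simp: inj_on_def dan_message_def)
    then have "Out j = ?S ` pverts G"
      using performs_dsf_complete[OF fin _ tree Out(1) j] by simp
    then show ?thesis
      using Out(2) dan_update_newton[OF inj same diff f_def] by simp
  qed
  have same: "x u k = x v k" if "u \<in> pverts G" "v \<in> pverts G" for u v k
    using that
  proof (induction k arbitrary: u v)
    case 0
    then show ?case using dan by (simp add: dan_def)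
  next
    case (Suc k)
    have "x u (Suc k) = ?N (x u k)" "x v (Suc k) = ?N (x v k)"
      using Suc by (blast intro: step)+
    then show ?case
      using Suc.IH[OF Suc.prems] by simp
  qed
  show ?thesis
    using step[OF same[OF _ i] i] .
qed

theorem theorem2:
  fixes n :: nat
    and fl :: "nat \<Rightarrow> real^'p \<Rightarrow> real" and f :: "real^'p \<Rightarrow> real"
    and \<mu> L \<gamma> :: real and k0 :: nat
    and G T :: "nat pair_pre_digraph" and ident :: "nat \<Rightarrow> 'id"
    and x0 :: "real^'p" and x :: "nat \<Rightarrow> nat \<Rightarrow> real^'p"
  assumes f_def: "f = (\<lambda>y. \<Sum>i\<in>{1..n}. fl i y)"
    and local_diff: "\<forall>i\<in>{1..n}. twice_differentiable (fl i)"
    and C2: "twice_cont_differentiable f"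
    and mu_pos: "\<mu> > 0"
    and strongly_convex: "\<forall>y. hess f y \<succeq> \<mu> *\<^sub>R mat 1"
    and L_pos: "L > 0"
    and Lipschitz: "\<forall>y z. spectral_norm (hess f y - hess f z) \<le> L * norm (y - z)"
    and nodes: "pverts G = {1..n}"
    and network: "pair_wf_digraph G"
    and connected: "strongly_connected G"
    and identifiers: "inj_on ident {1..n}"
    and tree: "symmetric G \<longrightarrow> undirected_spanning_tree T G"
    and DAN: "dan G T ident fl \<mu> L x0 x"
    and k0_def: "k0 = nat (max 0 (\<lceil>2 * L / \<mu>\<^sup>2 * norm (grad f x0)\<rceil> - 2))"
    and gamma_def: "\<gamma> = L / (2 * \<mu>\<^sup>2) * norm (grad f x0) - real k0 / 4"
  shows "\<gamma> \<in> {0..1/2} \<and>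
    (\<not> (2 * L / \<mu>\<^sup>2 * norm (grad f x0) \<in> \<int> \<and> 2 * L / \<mu>\<^sup>2 * norm (grad f x0) \<ge> 2)
       \<longrightarrow> \<gamma> \<in> {0..<1/2}) \<and>
    (\<exists>xs. (\<forall>z. (\<forall>y. f z \<le> f y) \<longleftrightarrow> z = xs) \<and>
      (\<forall>i\<in>{1..n}. x i \<longlonglongrightarrow> xs \<and>
        decseq (\<lambda>k. norm (grad f (x i k))) \<and>
        (\<forall>k. norm (grad f (x i k)) \<le>
          (if k \<le> k0 then norm (grad f x0) - \<mu>\<^sup>2 / (2 * L) * real k
           else 2 * \<mu>\<^sup>2 / L * \<gamma> ^ (2 ^ (k - k0)))) \<and>
        (\<forall>k. norm (x i k - xs) \<le>
          (if k \<le> k0 then \<mu> / L * (real k0 - real k + 2 * \<gamma> / (1 - \<gamma>))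
           else 2 * \<mu> * \<gamma> ^ (2 ^ (k - k0)) / (L * (1 - \<gamma> ^ (2 ^ (k - k0))))))))"
proof -
  let ?g = "grad f" and ?N = "\<lambda>y. norm (grad f y)"
  define s where "s y = L / \<mu>\<^sup>2 * ?N y" for y
  have pot: "GDERIV f y :> ?g y" for y
    using C2 by (intro grad_works) (simp add: twice_cont_differentiable_def twice_differentiable_def)
  interpret strongly_monotone_field ?g "hess f" \<mu> L
  proof
    show "(?g has_derivative (*v) (hess f y)) (at y)" for y
      using C2 by (intro hess_works) (simp add: twice_cont_differentiable_def twice_differentiable_def)
    show "\<mu> * (v \<bullet> v) \<le> v \<bullet> (hess f y *v v)" for y v
    proof -
      have "0 \<le> v \<bullet> ((hess f y - \<mu> *\<^sub>R mat 1) *v v)"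
        using strongly_convex by (simp add: loewner_ge_def)
      then show ?thesis
        by (simp add: matrix_vector_mult_diff_rdistrib inner_diff_right flip: scaleR_matrix_vector_assoc)
    qed
  qed (use mu_pos L_pos Lipschitz in auto)
  have rate: "damped_newton_rate (\<lambda>k. s (x i k)) k0 \<gamma>" if i: "i \<in> {1..n}" for i
  proof
    have x0: "x i 0 = x0"
      using DAN i by (simp add: dan_def nodes)
    have next_x: "x i (Suc k) = x i k - dan_stepsize \<mu> L (?g (x i k)) *\<^sub>R
        (matrix_inv (hess f (x i k)) *v ?g (x i k))" for k
      using dan_newton[OF DAN _ _ tree] nodes identifiers local_diff f_def i by simp
    show "0 \<le> s (x i k)" for k
      using L_pos by (simp add: s_def)
    show "s (x i (Suc k)) \<le> s (x i k) - 1/2" if "1 \<le> s (x i k)" for k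
      using dan_step(1)[of "x i k"] that unfolding s_def next_x by simp
    show "s (x i (Suc k)) \<le> (s (x i k))\<^sup>2 / 2" if "s (x i k) \<le> 1" for k
      using dan_step(2)[of "x i k"] that unfolding s_def next_x by simp
    show "k0 = nat (max 0 (\<lceil>2 * s (x i 0)\<rceil> - 2))"
      by (simp add: k0_def s_def x0 mult.assoc)
    show "\<gamma> = s (x i 0) / 2 - real k0 / 4"
      by (simp add: gamma_def s_def x0)
  qed
  have "1 \<in> {1..n}"
    using connected nodes by (auto simp: strongly_connected_def)
  interpret one: damped_newton_rate "\<lambda>k. s (x 1 k)" k0 \<gamma>
    using rate \<open>1 \<in> {1..n}\<close> by simp
  have N: "?N y = \<mu>\<^sup>2 / L * s y" for y
    using mu_pos L_pos by (simp add: s_def)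
  have N_tendsto: "(\<lambda>k. ?N (x i k)) \<longlonglongrightarrow> 0" if "i \<in> {1..n}" for i
    unfolding N by (rule tendsto_mult_right_zero[OF damped_newton_rate.s_tendsto[OF rate[OF that]]])
  obtain xs where zero: "?g xs = 0"
    using converges_to_zero[OF N_tendsto[OF \<open>1 \<in> {1..n}\<close>]] by blast
  \<comment> \<open>Strong monotonicity turns the gradient bounds into distance bounds, with room to spare.\<close>
  have dist: "norm (y - xs) \<le> \<mu> / L * s y" for y
    using norm_diff_le[of y xs] zero mu_pos L_pos
    by (simp add: N power2_eq_square field_simps)
  have x0: "x i 0 = x0" if "i \<in> {1..n}" for i
    using DAN that by (simp add: dan_def nodes)
  show ?thesis
  proof (intro conjI exI[of _ xs] ballI)
    show "\<gamma> \<in> {0..1/2}"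
      using one.gamma_nonneg one.gamma_le by simp
    show "\<not> (2 * L / \<mu>\<^sup>2 * ?N x0 \<in> \<int> \<and> 2 * L / \<mu>\<^sup>2 * ?N x0 \<ge> 2) \<longrightarrow> \<gamma> \<in> {0..<1/2}"
      using one.gamma_nonneg one.gamma_less x0[OF \<open>1 \<in> {1..n}\<close>]
      by (simp add: s_def mult.assoc)
    show "\<forall>z. (\<forall>y. f z \<le> f y) \<longleftrightarrow> z = xs"
      using minimizer_iff[OF pot zero] by blast
    fix i assume i: "i \<in> {1..n}"
    interpret i: damped_newton_rate "\<lambda>k. s (x i k)" k0 \<gamma>
      using rate[OF i] .
    show "x i \<longlonglongrightarrow> xs"
    proof -
      have lim: "(\<lambda>k. \<mu> / L * s (x i k)) \<longlonglongrightarrow> 0"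
        by (rule tendsto_mult_right_zero[OF i.s_tendsto])
      have "(\<lambda>k. norm (x i k - xs)) \<longlonglongrightarrow> 0"
        by (rule tendsto_sandwich[OF always_eventually always_eventually tendsto_const lim])
          (use dist in simp_all)
      then show ?thesis
        by (simp add: LIM_zero_iff tendsto_norm_zero_iff)
    qed
    show "decseq (\<lambda>k. ?N (x i k))"
      using i.decseq_s mu_pos L_pos unfolding N decseq_def by (simp add: divide_right_mono)
    show "\<forall>k. ?N (x i k) \<le> (if k \<le> k0 then ?N x0 - \<mu>\<^sup>2 / (2 * L) * real k
           else 2 * \<mu>\<^sup>2 / L * \<gamma> ^ (2 ^ (k - k0)))"
    proof
      fix k
      have "?N (x i k) \<le> \<mu>\<^sup>2 / L * (if k \<le> k0 then s x0 - real k / 2 else 2 * \<gamma> ^ (2 ^ (k - k0)))"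
        unfolding N by (rule mult_left_mono[OF i.s_le[of k, unfolded x0[OF i]]]) (use L_pos in simp)
      also have "\<dots> = (if k \<le> k0 then ?N x0 - \<mu>\<^sup>2 / (2 * L) * real k
           else 2 * \<mu>\<^sup>2 / L * \<gamma> ^ (2 ^ (k - k0)))"
        by (simp add: N right_diff_distrib diff_divide_distrib)
      finally show "?N (x i k) \<le> (if k \<le> k0 then ?N x0 - \<mu>\<^sup>2 / (2 * L) * real k
           else 2 * \<mu>\<^sup>2 / L * \<gamma> ^ (2 ^ (k - k0)))" .
    qed
    show "\<forall>k. norm (x i k - xs) \<le>
          (if k \<le> k0 then \<mu> / L * (real k0 - real k + 2 * \<gamma> / (1 - \<gamma>))
           else 2 * \<mu> * \<gamma> ^ (2 ^ (k - k0)) / (L * (1 - \<gamma> ^ (2 ^ (k - k0)))))"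
    proof
      fix k
      have "norm (x i k - xs) \<le> \<mu> / L * s (x i k)"
        by (rule dist)
      also have "\<dots> \<le> \<mu> / L * (if k \<le> k0 then real k0 - real k + 2 * \<gamma> / (1 - \<gamma>)
          else 2 * \<gamma> ^ (2 ^ (k - k0)) / (1 - \<gamma> ^ (2 ^ (k - k0))))"
        by (rule mult_left_mono[OF i.s_le_distance_bound]) (use mu_pos L_pos in simp)
      also have "\<dots> = (if k \<le> k0 then \<mu> / L * (real k0 - real k + 2 * \<gamma> / (1 - \<gamma>))
           else 2 * \<mu> * \<gamma> ^ (2 ^ (k - k0)) / (L * (1 - \<gamma> ^ (2 ^ (k - k0)))))"
        by (simp add: mult_ac)
      finally show "norm (x i k - xs) \<le>
          (if k \<le> k0 then \<mu> / L * (real k0 - real k + 2 * \<gamma> / (1 - \<gamma>))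
           else 2 * \<mu> * \<gamma> ^ (2 ^ (k - k0)) / (L * (1 - \<gamma> ^ (2 ^ (k - k0)))))" .
    qed
  qed
qed

end
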